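(* Let $T$ be a rooted tree. For every increasing coloring $f\colon V(T)\to\mathbb{Z}^+$ there exists a unique multiset $S$ of vertices of $T$ such that $f=f_S$.
   Context: $T$ is a finite rooted tree with root $v_T$. The coheight $h_v$ of a vertex $v$ is the length of the path from $v_T$ to $v$. $S_g$ denotes the subtree consisting of $g$ and all its descendants. A coloring $f\colon V(T)\to\mathbb{Z}^+$ is increasing if $f(u)<f(v)$ whenever $u$ is the parent of $v$. For a multiset $S$ of vertices, $f_S$ is the coloring $f_S(v)=1+h_v+\sum_{g\in S}\mathbb{1}_{V(S_g)}(v)$, the sum counted with multiplicity (i.e. $f_S(v)-1-h_v$ is the number of elements of $S$, with multiplicity, that are ancestors of $v$ or equal to $v$). *)

theory Defs
  imports "HOL-Library.Multiset" "HOL-Library.Indicator_Function" "Graph_Theory.Digraph_Component"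
begin

text \<open>
  As usual for \<open>graph\<close>, an undirected graph is a finite loop-free symmetric digraph without
  parallel arcs, and \<open>connected\<close> includes that there is at least one vertex. An undirected edge
  always gives rise to a \<open>cycle\<close> of length 2 (there and back), so that acyclicity of the undirected
  graph is the absence of cycles of length at least 3. For the same reason the library's \<open>forest\<close>
  and \<open>tree\<close> do not describe undirected trees: a symmetric digraph with an arc is never a
  \<open>forest\<close>, whereas every acyclic orientation of an undirected graph is one.
\<close>

locale rooted_tree = graph T for T :: "('a, 'b) pre_digraph" (structure) +
  fixes root :: 'a
  assumes connected_T: "Digraph_Component.connected T"
    and acyclic_T: "\<not> (\<exists>p. cycle p \<and> 3 \<le> length p)"
    and root_in_verts: "root \<in> verts T"
begin

definition root_path :: "'a \<Rightarrow> 'b awalk" where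
  "root_path v = (THE p. apath root p v)"

definition coheight :: "'a \<Rightarrow> nat" where
  "coheight v = length (root_path v)"

text \<open>The parent of a vertex other than the root is its neighbour on the path to the root.\<close>

definition parent :: "'a \<Rightarrow> 'a \<Rightarrow> bool" where
  "parent u v \<longleftrightarrow> v \<in> verts T \<and> v \<noteq> root \<and> u = tail T (last (root_path v))"

definition descendant :: "'a \<Rightarrow> 'a \<Rightarrow> bool" where
  "descendant v g \<longleftrightarrow> parent\<^sup>+\<^sup>+ g v"

definition subtree :: "'a \<Rightarrow> ('a, 'b) pre_digraph" where
  "subtree g = T \<restriction> {v \<in> verts T. v = g \<or> descendant v g}"

text \<open>
  A coloring \<open>V(T) \<rightarrow> \<int>\<^sup>+\<close> is a function on the vertex type, of which only the values on \<open>verts T\<close>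
  matter.
\<close>

definition coloring :: "('a \<Rightarrow> nat) \<Rightarrow> bool" where
  "coloring f \<longleftrightarrow> (\<forall>v \<in> verts T. 0 < f v)"

definition increasing :: "('a \<Rightarrow> nat) \<Rightarrow> bool" where
  "increasing f \<longleftrightarrow> (\<forall>u \<in> verts T. \<forall>v \<in> verts T. parent u v \<longrightarrow> f u < f v)"

definition multiset_coloring :: "'a multiset \<Rightarrow> 'a \<Rightarrow> nat" where
  "multiset_coloring S v = 1 + coheight v + (\<Sum>g \<in># S. indicator (verts (subtree g)) v)"

end

end

theory Submission
  imports Defs
begin

text \<open>
  In passing from the parent of \<open>v\<close> to \<open>v\<close>, the value of \<open>f\<^sub>S\<close> grows by one plus the multiplicity of
  \<open>v\<close> in \<open>S\<close>, since the only subtree that contains \<open>v\<close> but not its parent is the one rooted at \<open>v\<close>.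
  Thus \<open>f = f\<^sub>S\<close> says precisely that the multiplicity of the root is \<open>f root - 1\<close> and that of any other
  vertex \<open>v\<close> with parent \<open>u\<close> is \<open>f v - f u - 1\<close>. Paths from the root are unique
  because two distinct paths with common ends and of least total length would be internally disjoint
  and so form a cycle.
\<close>

section \<open>Reversing and splitting walks; uniqueness of paths in a graph without cycles of
  length at least 3\<close>

lemma (in sym_digraph) awalk_reverse:
  assumes "awalk u p v"
  shows "\<exists>q. awalk v q u \<and> awalk_verts v q = rev (awalk_verts u p)"
  using assms
proof (induction p arbitrary: u)
  case Nil
  then show ?case by (intro exI[of _ "[]"]) (auto simp: awalk_Nil_iff)
next
  case (Cons a p)
  then have a: "a \<in> arcs G" "u = tail G a" and p: "awalk (head G a) p v"
    by (auto simp: awalk_Cons_iff)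
  from Cons.IH[OF p] obtain q
    where q: "awalk v q (head G a)" "awalk_verts v q = rev (awalk_verts (head G a) p)"
    by blast
  from a(1) sym_arcs obtain b where b: "b \<in> arcs G" "tail G b = head G a" "head G b = tail G a"
    unfolding symmetric_conv by metis
  have "awalk (head G a) [b] u"
    using a b by (auto simp: awalk_simps)
  with q(1) have w: "awalk v (q @ [b]) u"
    by (rule awalk_appendI)
  then have "awalk_verts v (q @ [b]) = rev (awalk_verts u (a # p))"
    using q(2) a b by (simp add: awalk_verts_append[OF w])
  with w show ?case by blast
qed

lemma (in wf_digraph) apath_decomp:
  assumes "apath u p v" "w \<in> set (awalk_verts u p)"
  obtains q r where "p = q @ r" "apath u q w" "apath w r v"
proof -
  obtain q r where qr: "p = q @ r" "awalk u q w" "awalk w r v"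
    using assms awalk_decomp by (metis apath_def)
  moreover from qr(2) have "awlast u q = w"
    by auto
  ultimately show ?thesis
    using assms(1) that by (auto simp: apath_append_iff)
qed

lemma (in graph) apath_unique:
  assumes acyclic: "\<not> (\<exists>p. cycle p \<and> 3 \<le> length p)"
    and "apath u p v" "apath u q v"
  shows "p = q"
  using assms(2,3)
proof (induction "length p + length q" arbitrary: u p v q rule: less_induct)
  case less
  show ?case
  proof (cases "p = [] \<or> q = []")
    case True
    then show ?thesis
      using less.prems apath_nonempty_ends by (metis apath_Nil_iff)
  next
    case nonempty: False
    then have "u \<noteq> v"
      using less.prems apath_nonempty_ends by blast
    have p: "awalk u p v" "distinct (awalk_verts u p)"
      and q: "awalk u q v" "distinct (awalk_verts u q)"
      using less.prems by (auto simp: apath_def)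
    show ?thesis
    proof (cases "\<exists>w. w \<in> set (awalk_verts u p) \<and> w \<in> set (awalk_verts u q) \<and> w \<noteq> u \<and> w \<noteq> v")
      case True
      then obtain w where w: "w \<in> set (awalk_verts u p)" "w \<in> set (awalk_verts u q)" "w \<noteq> u" "w \<noteq> v"
        by blast
      obtain p1 p2 where p12: "p = p1 @ p2" "apath u p1 w" "apath w p2 v"
        using apath_decomp[OF less.prems(1) w(1)] .
      obtain q1 q2 where q12: "q = q1 @ q2" "apath u q1 w" "apath w q2 v"
        using apath_decomp[OF less.prems(2) w(2)] .
      \<comment> \<open>As \<open>w\<close> is neither end, no piece is empty, so \<open>p1\<close>,
        \<open>q1\<close> and likewise \<open>p2\<close>, \<open>q2\<close> have smaller total
        length than \<open>p\<close>, \<open>q\<close>.\<close>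
      have "p1 \<noteq> []" "p2 \<noteq> []" "q1 \<noteq> []" "q2 \<noteq> []"
        using p12(2,3) q12(2,3) w(3,4) by (auto simp: apath_Nil_iff)
      then have "p1 = q1" "p2 = q2"
        using less.hyps[OF _ p12(2) q12(2)] less.hyps[OF _ p12(3) q12(3)] p12(1) q12(1) by auto
      with p12(1) q12(1) show ?thesis by simp
    next
      case disjoint: False
      \<comment> \<open>The way back along \<open>q\<close> uses opposite arcs; what is known of it
        is its vertex list, from which its length is read off.\<close>
      obtain r where r: "awalk v r u" "awalk_verts v r = rev (awalk_verts u q)"
        using awalk_reverse[OF q(1)] by blast
      from r(2) have len: "length r = length q"
        by (metis Suc_inject length_awalk_verts length_rev)
      have pr: "awalk u (p @ r) u"
        using p(1) r(1) by (rule awalk_appendI)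
      have "awlast u p = v" "awhd u p = u" "awlast u q = v"
        using p(1) q(1) by auto
      \<comment> \<open>\<open>cycle\<close> asks for distinctness of the vertex list without its
        head, so that the common start and end \<open>u\<close> counts once. Here this list is that
        of \<open>p\<close> without \<open>u\<close>, followed by that of \<open>q\<close> without
        \<open>v\<close>, reversed.\<close>
      have tl_r: "tl (awalk_verts v r) = rev (butlast (awalk_verts u q))"
        unfolding r(2) by (metis butlast_rev rev_rev_ident)
      have verts_eq: "tl (awalk_verts u (p @ r)) = tl (awalk_verts u p) @ rev (butlast (awalk_verts u q))"
        using awalk_verts_append[OF pr] \<open>awlast u p = v\<close> tl_r by simp
      have "u \<notin> set (tl (awalk_verts u p))"
        using p(2) \<open>awhd u p = u\<close> by (cases "awalk_verts u p") auto
      moreover have "v \<notin> set (butlast (awalk_verts u q))"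
        using q(2) \<open>awlast u q = v\<close>
        by (metis append_butlast_last_id awalk_verts_non_Nil distinct_append distinct.simps(2)
            disjoint_insert(1) list.simps(15) inf_commute)
      \<comment> \<open>A vertex in both parts would differ from \<open>u\<close> because of the
        first and from \<open>v\<close> because of the second, hence be a shared inner
        vertex.\<close>
      ultimately have "set (tl (awalk_verts u p)) \<inter> set (butlast (awalk_verts u q)) = {}"
        using disjoint by (auto dest: in_set_butlastD list.set_sel(2)[OF awalk_verts_non_Nil])
      then have "distinct (tl (awalk_verts u (p @ r)))"
        unfolding verts_eq using p(2) q(2) by (simp add: distinct_tl distinct_butlast)
      then have "cycle (p @ r)"
        using pr nonempty unfolding cycle_def by blast
      \<comment> \<open>A cycle of length 2 is not excluded; then \<open>p\<close> and
        \<open>q\<close> are single arcs with the same ends, and these agree as there are no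
        parallel arcs.\<close>
      with acyclic len have "length p + length q < 3"
        by (metis length_append not_le)
      with nonempty have "length p = 1" "length q = 1"
        by (cases p; cases q; simp)+
      then obtain a b where "p = [a]" "q = [b]"
        by (metis One_nat_def length_0_conv length_Suc_conv)
      with p(1) q(1) show ?thesis
        by (auto simp: awalk_simps arc_to_ends_def intro: no_multi_arcs)
    qed
  qed
qed

section \<open>Coheight, parents and descendants\<close>

context rooted_tree
begin

text \<open>By symmetry, connectedness is strong connectedness, so a path exists; uniqueness then
  justifies the description in \<open>root_path\<close>.\<close>

lemma apath_root_path:
  assumes "v \<in> verts T"
  shows "apath root (root_path v) v"
proof -
  have "strongly_connected T"
    using connected_T sym_arcs symmetric_connected_imp_strongly_connected by blast
  then obtain p where p: "apath root p v"
    using assms root_in_verts reachable_apath by blast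
  then show ?thesis
    unfolding root_path_def by (rule theI) (rule apath_unique[OF acyclic_T _ p])
qed

lemma root_path_eq: "apath root p v \<Longrightarrow> root_path v = p"
  using apath_unique[OF acyclic_T] apath_root_path unfolding apath_def
  by (meson awalk_last_in_verts)

lemma coheight_root: "coheight root = 0"
  using root_path_eq[of "[]" root] root_in_verts by (simp add: coheight_def apath_Nil_iff)

lemma not_parent_root: "\<not> parent u root"
  by (simp add: parent_def)

lemma parent_unique: "parent u v \<Longrightarrow> parent w v \<Longrightarrow> u = w"
  by (simp add: parent_def)

lemma parent_exists: "v \<in> verts T \<Longrightarrow> v \<noteq> root \<Longrightarrow> \<exists>u. parent u v"
  by (simp add: parent_def)

text \<open>Without its last arc, the path to \<open>v\<close> is a path from the root to
  \<open>u\<close>, hence equal to \<open>root_path u\<close> by uniqueness.\<close>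

lemma parent_props:
  assumes "parent u v"
  shows parent_in_verts: "u \<in> verts T"
    and child_in_verts: "v \<in> verts T"
    and coheight_child: "coheight v = Suc (coheight u)"
proof -
  have v: "v \<in> verts T" "v \<noteq> root" and u: "u = tail T (last (root_path v))"
    using assms by (auto simp: parent_def)
  have path: "apath root (root_path v) v"
    using v(1) by (rule apath_root_path)
  with v(2) have "root_path v \<noteq> []"
    by (auto simp: apath_Nil_iff)
  then obtain p a where pa: "root_path v = p @ [a]"
    by (metis append_butlast_last_id)
  with path u have "apath root p u"
    by (auto simp: apath_append_iff apath_Cons_iff)
  then have "root_path u = p"
    by (rule root_path_eq)
  with pa show "coheight v = Suc (coheight u)"
    by (simp add: coheight_def)
  show "u \<in> verts T" "v \<in> verts T"
    using \<open>apath root p u\<close> v(1) by (auto simp: apath_def)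
qed

lemma vertex_induct [consumes 1, case_names root child]:
  assumes "v \<in> verts T"
    and "P root"
    and "\<And>u v. parent u v \<Longrightarrow> P u \<Longrightarrow> P v"
  shows "P v"
  using assms(1)
proof (induction "coheight v" arbitrary: v rule: less_induct)
  case less
  show ?case
  proof (cases "v = root")
    case False
    with less.prems obtain u where "parent u v"
      using parent_exists by blast
    with less.hyps show ?thesis
      using assms(3) parent_in_verts coheight_child by simp
  qed (use assms(2) in simp)
qed

text \<open>Rules out proper ancestors of the root, and a parent that descends from its own
  child.\<close>

lemma coheight_descendant: "descendant v g \<Longrightarrow> coheight g < coheight v"
  unfolding descendant_def by (induction rule: tranclp_induct) (simp_all add: coheight_child)

lemma not_descendant_root: "\<not> descendant root g"
  by (auto dest: coheight_descendant simp: coheight_root)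

text \<open>The last step of a chain of parents ending in \<open>v\<close> can only come from
  \<open>u\<close>, the one parent of \<open>v\<close>.\<close>

lemma descendant_child:
  assumes "parent u v"
  shows "descendant v g \<longleftrightarrow> u = g \<or> descendant u g"
proof
  assume "descendant v g"
  then show "u = g \<or> descendant u g"
    unfolding descendant_def
    by (cases rule: tranclp.cases) (use assms parent_unique in blast)+
next
  assume "u = g \<or> descendant u g"
  then show "descendant v g"
    using assms unfolding descendant_def by (auto intro: tranclp.intros)
qed

lemma in_subtree_iff: "v \<in> verts T \<Longrightarrow> v \<in> verts (subtree g) \<longleftrightarrow> v = g \<or> descendant v g"
  by (simp add: subtree_def)

section \<open>The values of \<open>multiset_coloring S\<close> at the root and their growth along
  edges\<close>

lemma multiset_coloring_root: "multiset_coloring S root = 1 + count S root"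
proof -
  have "(indicator (verts (subtree g)) root :: nat) = (if g = root then 1 else 0)" for g
    using in_subtree_iff[OF root_in_verts] not_descendant_root by (auto simp: indicator_def)
  then show ?thesis
    by (simp add: multiset_coloring_def coheight_root sum_mset_delta)
qed

lemma multiset_coloring_child:
  assumes "parent u v"
  shows "multiset_coloring S v = multiset_coloring S u + 1 + count S v"
proof -
  have uv: "u \<in> verts T" "v \<in> verts T"
    using assms by (fact parent_in_verts child_in_verts)+
  have "(indicator (verts (subtree g)) v :: nat) =
      indicator (verts (subtree g)) u + (if g = v then 1 else 0)" for g
  proof -
    \<comment> \<open>The parent lies outside the subtree of \<open>v\<close>, so for
      \<open>g = v\<close> the indicator rises from 0 to 1.\<close>
    have "\<not> (u = v \<or> descendant u v)"
      using coheight_descendant[of u v] coheight_child[OF assms] by auto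
    then show ?thesis
      using in_subtree_iff[OF uv(1)] in_subtree_iff[OF uv(2)] descendant_child[OF assms]
      by (auto simp: indicator_def)
  qed
  then show ?thesis
    by (simp add: multiset_coloring_def coheight_child[OF assms] sum_mset.distrib sum_mset_delta)
qed

text \<open>Existence and uniqueness are both read off from these equations. Their additive form
  avoids truncated subtraction.\<close>

lemma eq_multiset_coloring_iff:
  "(\<forall>v \<in> verts T. f v = multiset_coloring S v) \<longleftrightarrow>
    f root = 1 + count S root \<and> (\<forall>u v. parent u v \<longrightarrow> f v = f u + 1 + count S v)"
  (is "?eq \<longleftrightarrow> ?steps")
proof
  assume ?eq
  then show ?steps
    using multiset_coloring_root multiset_coloring_child root_in_verts parent_in_verts child_in_verts
    by simp
next
  assume ?steps
  show ?eq
  proof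
    fix v assume "v \<in> verts T"
    then show "f v = multiset_coloring S v"
      by (induction rule: vertex_induct)
        (use \<open>?steps\<close> multiset_coloring_root multiset_coloring_child in auto)
  qed
qed

end

section \<open>Recovering the multiset from an increasing coloring\<close>

theorem theorem4p2:
  fixes T :: "('a, 'b) pre_digraph" and root :: 'a and f :: "'a \<Rightarrow> nat"
  assumes "rooted_tree T root"
    and "rooted_tree.coloring T f"
    and "rooted_tree.increasing T root f"
  shows "\<exists>!S :: 'a multiset. set_mset S \<subseteq> verts T \<and>
           (\<forall>v \<in> verts T. f v = rooted_tree.multiset_coloring T root S v)"
proof -
  interpret rooted_tree T root by fact
  \<comment> \<open>The equations solved for the multiplicities.\<close>
  define m where
    "m v = (if v = root then f root - 1 else f v - f (THE u. parent u v) - 1)" for v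
  have m_child: "m v = f v - f u - 1" if "parent u v" for u v
  proof -
    have "(THE u. parent u v) = u"
      using that parent_unique by blast
    then show ?thesis
      using that not_parent_root by (auto simp: m_def)
  qed
  define S where "S = (\<Sum>v\<in>verts T. replicate_mset (m v) v)"
  have count_S: "count S v = (if v \<in> verts T then m v else 0)" for v
    by (simp add: S_def count_sum)
  show ?thesis
  proof (rule ex1I[of _ S])
    have "set_mset S \<subseteq> verts T"
      by (metis count_S not_in_iff subsetI)
    \<comment> \<open>Positivity of \<open>f root\<close> keeps \<open>f root - 1\<close> from being
      truncated.\<close>
    moreover have "f root = 1 + count S root"
      using assms(2) root_in_verts by (simp add: count_S m_def coloring_def)
    moreover have "f v = f u + 1 + count S v" if "parent u v" for u v
    proof -
      \<comment> \<open>This makes \<open>f v - f u - 1\<close> an exact difference.\<close>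
      have "f u < f v"
        using assms(3) that parent_in_verts child_in_verts unfolding increasing_def by blast
      then show ?thesis
        using that child_in_verts by (simp add: count_S m_child)
    qed
    ultimately show "set_mset S \<subseteq> verts T \<and> (\<forall>v \<in> verts T. f v = multiset_coloring S v)"
      unfolding eq_multiset_coloring_iff by blast
  next
    fix S' assume S': "set_mset S' \<subseteq> verts T \<and> (\<forall>v \<in> verts T. f v = multiset_coloring S' v)"
    show "S' = S"
    proof (rule multiset_eqI)
      fix v
      consider "v \<notin> verts T" | "v = root" | u where "parent u v"
        using parent_exists by blast
      then show "count S' v = count S v"
      proof cases
        \<comment> \<open>The equations do not determine multiplicities outside the tree; the
          support condition makes them 0.\<close>
        case 1
        with S' show ?thesis
          by (metis count_S not_in_iff subsetD)
      next
        case 2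
        with S' show ?thesis
          using root_in_verts unfolding eq_multiset_coloring_iff by (simp add: count_S m_def)
      next
        case 3
        with S' show ?thesis
          using child_in_verts unfolding eq_multiset_coloring_iff by (simp add: count_S m_child)
      qed
    qed
  qed
qed

end
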